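(* Let $\Phi$ be a linear flow on a vector bundle $\pi:\mathcal{V}\to B$ over a compact chain transitive metric space $B$. Let ${}_{\mathbb{S}}M_j$ be a chain recurrent component of the induced flow $\mathbb{S}\Phi$ on the sphere bundle $\mathbb{S}\mathcal{V}$ and let $\mathcal{V}_j^+=\{\alpha v\in\mathcal{V}\mid \alpha>0,\ v\in{}_{\mathbb{S}}M_j\}$ be the cone bundle generated by it. Then the following assertions are equivalent: (a) The set $\overline{\pi_P\mathcal{V}_j^+}$ is chain transitive on the closed upper hemisphere $\overline{\mathbb{S}_P^+\mathcal{V}}$ of the Poincaré sphere bundle. (b) The cone bundle $\mathcal{V}_j^+$ contains a half-line $l=\{\alpha v_0\mid\alpha>0\}$ for some $v_0\in{}_{\mathbb{S}}M_j$ such that $\pi_P l$ is chain transitive on $\mathbb{S}_P^+\mathcal{V}$.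
   Context: Vector bundle: $H$ is a finite-dimensional real Hilbert space, $B$ a compact metric space, $\mathcal{V}$ a topological space, $\pi:\mathcal{V}\to B$ continuous, with a finite open cover $\{U_a\}_{a\in A}$ of $B$ and homeomorphisms $\varphi_a:\pi^{-1}(U_a)\to U_a\times H$ with $\mathrm{pr}_1\circ\varphi_a=\pi$, such that the transition maps are linear on fibers, i.e. $\varphi_{a'}\circ\varphi_a^{-1}(b,h)=(b,L_{a'a}(b)h)$ with $L_{a'a}(b):H\to H$ linear for $b\in U_a\cap U_{a'}$ (each $\varphi_a$ may be assumed to extend to a homeomorphism $\overline{\pi^{-1}(U_a)}\to\overline{U_a}\times H$). Fibers $\mathcal{V}_b=\pi^{-1}(b)$ are vector spaces via the $\varphi_a$, with the continuous inner product $\langle v,v'\rangle=\sum_{a\in A}d(\pi(v),B\setminus U_a)\langle v,v'\rangle_a$ for $\pi(v)=\pi(v')$, where $\langle v,v'\rangle_a=\langle x,x'\rangle_H$ if $v=\varphi_a^{-1}(b,x)$, $v'=\varphi_a^{-1}(b,x')$; $\|\cdot\|$ is the corresponding norm on fibers. Linear flow: a continuous flow $\Phi$ on $\mathcal{V}$ mapping fibers to fibers and linear on fibers. It induces a flow on $B$, and $B$ is assumed chain transitive for this flow. Sphere bundle: $\mathbb{S}\mathcal{V}=\{v\in\mathcal{V}\mid\|v\|=1\}$ (compact), with induced flow $\mathbb{S}\Phi(t,v)=\Phi(t,v)/\|\Phi(t,v)\|$. Chains: for a flow $\Psi$ on a metric space $X$ and $\varepsilon,T>0$, an $(\varepsilon,T)$-chain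 from $x$ to $y$ is given by $n\in\mathbb{N}$ ($n\ge1$), $T_0,\dots,T_{n-1}\ge T$ and $x_0=x,x_1,\dots,x_n=y\in X$ with $d(\Psi(T_i,x_i),x_{i+1})<\varepsilon$ for $i=0,\dots,n-1$. $\Omega(x)$ is the set of $y\in X$ such that for all $\varepsilon,T>0$ there is an $(\varepsilon,T)$-chain from $x$ to $y$. A set is chain transitive (on $X$) if $y\in\Omega(x)$ for all $x,y$ in the set (chain points may lie anywhere in $X$). A chain recurrent component is a maximal chain transitive set. Poincaré sphere bundle: $\mathcal{V}^1=\mathcal{V}\times\mathbb{R}\to B$, $(v,r)\mapsto\pi(v)$, is a vector bundle with fiber $H\times\mathbb{R}$ and trivializations $(v,r)\mapsto(b,(x,r))$ for $(b,x)=\varphi_a(v)$; the fiber norm is $\|(v,r)\|=\sqrt{\|v\|^2+r^2}$. $\mathbb{S}\mathcal{V}^1=\{(v,r)\mid\|(v,r)\|=1\}$ is the Poincaré sphere bundle. The map $\pi_P:\mathcal{V}\to\mathbb{S}\mathcal{V}^1$, $\pi_P(v)=\left(\frac{v}{\|(v,1)\|},\frac{1}{\|(v,1)\|}\right)$, is a homeomorphism onto the open upper hemisphere $\mathbb{S}_P^+\mathcal{V}=\{(v,r)\in\mathbb{S}\mathcal{V}^1\mid r>0\}$; its closure is $\overline{\mathbb{S}_P^+\mathcal{V}}=\{(v,r)\in\mathbb{S}\mathcal{V}^1\mid r\ge0\}$. The linear flow $\Phi^1(t,(v,r))=(\Phi(t,v),r)$ on $\mathcal{V}^1$ induces the flow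 $\mathbb{S}\Phi^1=\Phi^1/\|\Phi^1\|$ on $\mathbb{S}\mathcal{V}^1$; on $\mathbb{S}_P^+\mathcal{V}$ it restricts to $\pi_P\Phi(t,\pi_Pv)=\pi_P(\Phi(t,v))$. Chain transitivity on $\overline{\mathbb{S}_P^+\mathcal{V}}$ and on $\mathbb{S}_P^+\mathcal{V}$ refers to these flows. $\mathbb{S}\mathcal{V}$ and $\mathbb{S}\mathcal{V}^1$ are compact metrizable and carry fixed metrics compatible with their topologies (by compactness the notions do not depend on the choice); subsets carry the restricted metrics. *)

theory Defs
  imports "HOL-Analysis.Analysis"
begin

section \<open>Chains\<close>

text \<open>Here \<open>X\<close> is the space on which the flow lives and \<open>d\<close> its metric; all points of a
  chain have to lie in \<open>X\<close>.\<close>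

definition is_chain ::
    "'x set \<Rightarrow> ('x \<Rightarrow> 'x \<Rightarrow> real) \<Rightarrow> (real \<Rightarrow> 'x \<Rightarrow> 'x) \<Rightarrow> real \<Rightarrow> real \<Rightarrow> 'x \<Rightarrow> 'x \<Rightarrow> bool" where
  "is_chain X d \<Psi> \<epsilon> T x y \<longleftrightarrow>
     (\<exists>n \<tau> \<xi>. n \<ge> (1::nat) \<and> \<xi> 0 = x \<and> \<xi> n = y \<and> (\<forall>i\<le>n. \<xi> i \<in> X) \<and>
        (\<forall>i<n. \<tau> i \<ge> T \<and> d (\<Psi> (\<tau> i) (\<xi> i)) (\<xi> (Suc i)) < \<epsilon>))"

definition chain_limit_set ::
    "'x set \<Rightarrow> ('x \<Rightarrow> 'x \<Rightarrow> real) \<Rightarrow> (real \<Rightarrow> 'x \<Rightarrow> 'x) \<Rightarrow> 'x \<Rightarrow> 'x set" where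
  "chain_limit_set X d \<Psi> x = {y \<in> X. \<forall>\<epsilon>>0. \<forall>T>0. is_chain X d \<Psi> \<epsilon> T x y}"

definition chain_transitive ::
    "'x set \<Rightarrow> ('x \<Rightarrow> 'x \<Rightarrow> real) \<Rightarrow> (real \<Rightarrow> 'x \<Rightarrow> 'x) \<Rightarrow> 'x set \<Rightarrow> bool" where
  "chain_transitive X d \<Psi> M \<longleftrightarrow> M \<subseteq> X \<and> (\<forall>x\<in>M. \<forall>y\<in>M. y \<in> chain_limit_set X d \<Psi> x)"

definition chain_recurrent_component ::
    "'x set \<Rightarrow> ('x \<Rightarrow> 'x \<Rightarrow> real) \<Rightarrow> (real \<Rightarrow> 'x \<Rightarrow> 'x) \<Rightarrow> 'x set \<Rightarrow> bool" where
  "chain_recurrent_component X d \<Psi> M \<longleftrightarrow>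
     chain_transitive X d \<Psi> M \<and> (\<forall>N. chain_transitive X d \<Psi> N \<and> M \<subseteq> N \<longrightarrow> N = M)"

definition compatible_metric :: "'x::topological_space set \<Rightarrow> ('x \<Rightarrow> 'x \<Rightarrow> real) \<Rightarrow> bool" where
  "compatible_metric X d \<longleftrightarrow>
     Metric_space X d \<and> Metric_space.mtopology X d = top_of_set X"


section \<open>Vector bundles\<close>

text \<open>The total space and the base are the types \<open>'v\<close> and \<open>'b\<close>, the model fiber is \<open>'h\<close>.
  A bundle consists of the projection, the index set of the cover, the cover and the
  trivializations; the value of a trivialization outside the preimage of its cover set is
  irrelevant.\<close>

record ('v, 'b, 'h, 'a) vbundle =
  bproj :: "'v \<Rightarrow> 'b"
  bindex :: "'a set"
  bcover :: "'a \<Rightarrow> 'b set"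
  btriv :: "'a \<Rightarrow> 'v \<Rightarrow> 'b \<times> 'h"

definition part_over :: "('v, 'b, 'h, 'a) vbundle \<Rightarrow> 'a \<Rightarrow> 'v set" where
  "part_over E a = bproj E -` bcover E a"

definition triv_inv :: "('v, 'b, 'h, 'a) vbundle \<Rightarrow> 'a \<Rightarrow> 'b \<times> 'h \<Rightarrow> 'v" where
  "triv_inv E a = inv_into (part_over E a) (btriv E a)"

definition transition :: "('v, 'b, 'h, 'a) vbundle \<Rightarrow> 'a \<Rightarrow> 'a \<Rightarrow> 'b \<Rightarrow> 'h \<Rightarrow> 'h" where
  "transition E a' a b h = snd (btriv E a' (triv_inv E a (b, h)))"

text \<open>The last conjunct, extension of the trivializations to the closures, is what makes the
  fiber inner product below continuous at boundary points of the cover sets.\<close>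

definition vector_bundle ::
    "('v::topological_space, 'b::metric_space, 'h::euclidean_space, 'a) vbundle \<Rightarrow> bool" where
  "vector_bundle E \<longleftrightarrow>
     compact (UNIV :: 'b set) \<and>
     continuous_on UNIV (bproj E) \<and>
     finite (bindex E) \<and>
     (\<forall>a\<in>bindex E. open (bcover E a)) \<and>
     (\<Union>a\<in>bindex E. bcover E a) = UNIV \<and>
     (\<forall>a\<in>bindex E. \<exists>g. homeomorphism (part_over E a) (bcover E a \<times> UNIV) (btriv E a) g) \<and>
     (\<forall>a\<in>bindex E. \<forall>v\<in>part_over E a. fst (btriv E a v) = bproj E v) \<and>
     (\<forall>a\<in>bindex E. \<forall>a'\<in>bindex E. \<forall>b\<in>bcover E a \<inter> bcover E a'. linear (transition E a' a b)) \<and>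
     (\<forall>a\<in>bindex E. \<exists>f g.
        homeomorphism (closure (part_over E a)) (closure (bcover E a) \<times> UNIV) f g \<and>
        (\<forall>v\<in>part_over E a. f v = btriv E a v))"

text \<open>The vector space operations of the fibers are read off in some trivialization around the
  base point; by linearity of the transition maps the choice does not matter.\<close>

definition index_at :: "('v, 'b, 'h, 'a) vbundle \<Rightarrow> 'b \<Rightarrow> 'a" where
  "index_at E b = (SOME a. a \<in> bindex E \<and> b \<in> bcover E a)"

definition fib_add ::
    "('v, 'b, 'h::real_vector, 'a) vbundle \<Rightarrow> 'v \<Rightarrow> 'v \<Rightarrow> 'v" where
  "fib_add E v w =
     (let a = index_at E (bproj E v)
      in triv_inv E a (bproj E v, snd (btriv E a v) + snd (btriv E a w)))"

definition fib_scale ::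
    "('v, 'b, 'h::real_vector, 'a) vbundle \<Rightarrow> real \<Rightarrow> 'v \<Rightarrow> 'v" where
  "fib_scale E c v =
     (let a = index_at E (bproj E v)
      in triv_inv E a (bproj E v, c *\<^sub>R snd (btriv E a v)))"

text \<open>The distance to the complement of a cover set. Since \<open>infdist b {} = 0\<close>, the case of an
  empty complement needs a (positive) convention; otherwise the inner product of a globally
  trivialized bundle would vanish.\<close>

definition cover_weight :: "('v, 'b::metric_space, 'h, 'a) vbundle \<Rightarrow> 'a \<Rightarrow> 'b \<Rightarrow> real" where
  "cover_weight E a b = (if bcover E a = UNIV then 1 else infdist b (- bcover E a))"

text \<open>The inner product of two vectors over the same base point \<open>b\<close>; terms with
  \<open>b \<notin> bcover E a\<close> have weight 0.\<close>

definition fib_inner ::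
    "('v, 'b::metric_space, 'h::real_inner, 'a) vbundle \<Rightarrow> 'v \<Rightarrow> 'v \<Rightarrow> real" where
  "fib_inner E v w =
     (\<Sum>a\<in>bindex E. cover_weight E a (bproj E v) * (snd (btriv E a v) \<bullet> snd (btriv E a w)))"

definition fib_norm :: "('v, 'b::metric_space, 'h::real_inner, 'a) vbundle \<Rightarrow> 'v \<Rightarrow> real" where
  "fib_norm E v = sqrt (fib_inner E v v)"


section \<open>Linear flows and the sphere bundle\<close>

definition linear_flow ::
    "('v::topological_space, 'b::metric_space, 'h::euclidean_space, 'a) vbundle
       \<Rightarrow> (real \<Rightarrow> 'v \<Rightarrow> 'v) \<Rightarrow> bool" where
  "linear_flow E \<Phi> \<longleftrightarrow>
     continuous_on UNIV (\<lambda>(t, v). \<Phi> t v) \<and>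
     (\<forall>v. \<Phi> 0 v = v) \<and>
     (\<forall>s t v. \<Phi> (s + t) v = \<Phi> s (\<Phi> t v)) \<and>
     (\<forall>t v w. bproj E v = bproj E w \<longrightarrow> bproj E (\<Phi> t v) = bproj E (\<Phi> t w)) \<and>
     (\<forall>t v w. bproj E v = bproj E w \<longrightarrow> \<Phi> t (fib_add E v w) = fib_add E (\<Phi> t v) (\<Phi> t w)) \<and>
     (\<forall>t c v. \<Phi> t (fib_scale E c v) = fib_scale E c (\<Phi> t v))"

definition base_flow ::
    "('v, 'b, 'h, 'a) vbundle \<Rightarrow> (real \<Rightarrow> 'v \<Rightarrow> 'v) \<Rightarrow> real \<Rightarrow> 'b \<Rightarrow> 'b" where
  "base_flow E \<Phi> t b = bproj E (\<Phi> t (SOME v. bproj E v = b))"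

definition sphere_bundle ::
    "('v, 'b::metric_space, 'h::real_inner, 'a) vbundle \<Rightarrow> 'v set" where
  "sphere_bundle E = {v. fib_norm E v = 1}"

definition sphere_flow ::
    "('v, 'b::metric_space, 'h::real_inner, 'a) vbundle
       \<Rightarrow> (real \<Rightarrow> 'v \<Rightarrow> 'v) \<Rightarrow> real \<Rightarrow> 'v \<Rightarrow> 'v" where
  "sphere_flow E \<Phi> t v = fib_scale E (1 / fib_norm E (\<Phi> t v)) (\<Phi> t v)"

definition half_line :: "('v, 'b, 'h::real_vector, 'a) vbundle \<Rightarrow> 'v \<Rightarrow> 'v set" where
  "half_line E v = {fib_scale E \<alpha> v | \<alpha>. \<alpha> > 0}"

definition cone_bundle :: "('v, 'b, 'h::real_vector, 'a) vbundle \<Rightarrow> 'v set \<Rightarrow> 'v set" where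
  "cone_bundle E M = {fib_scale E \<alpha> v | \<alpha> v. \<alpha> > 0 \<and> v \<in> M}"


section \<open>The Poincare sphere bundle\<close>

definition ext_bundle ::
    "('v, 'b, 'h, 'a) vbundle \<Rightarrow> ('v \<times> real, 'b, 'h \<times> real, 'a) vbundle" where
  "ext_bundle E =
     \<lparr>bproj = (\<lambda>(v, r). bproj E v),
      bindex = bindex E,
      bcover = bcover E,
      btriv = (\<lambda>a (v, r). (fst (btriv E a v), (snd (btriv E a v), r)))\<rparr>"

text \<open>The norm on \<open>ext_bundle E\<close> is not \<open>fib_norm (ext_bundle E)\<close>: there the real component
  would be multiplied by the sum of the weights of the cover sets.\<close>

definition ext_norm ::
    "('v, 'b::metric_space, 'h::real_inner, 'a) vbundle \<Rightarrow> 'v \<times> real \<Rightarrow> real" where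
  "ext_norm E = (\<lambda>(v, r). sqrt ((fib_norm E v)\<^sup>2 + r\<^sup>2))"

definition ext_flow :: "(real \<Rightarrow> 'v \<Rightarrow> 'v) \<Rightarrow> real \<Rightarrow> 'v \<times> real \<Rightarrow> 'v \<times> real" where
  "ext_flow \<Phi> t = (\<lambda>(v, r). (\<Phi> t v, r))"

definition poincare_sphere ::
    "('v, 'b::metric_space, 'h::real_inner, 'a) vbundle \<Rightarrow> ('v \<times> real) set" where
  "poincare_sphere E = {p. ext_norm E p = 1}"

definition upper_hemisphere ::
    "('v, 'b::metric_space, 'h::real_inner, 'a) vbundle \<Rightarrow> ('v \<times> real) set" where
  "upper_hemisphere E = {(v, r). (v, r) \<in> poincare_sphere E \<and> r > 0}"

definition closed_upper_hemisphere ::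
    "('v, 'b::metric_space, 'h::real_inner, 'a) vbundle \<Rightarrow> ('v \<times> real) set" where
  "closed_upper_hemisphere E = {(v, r). (v, r) \<in> poincare_sphere E \<and> r \<ge> 0}"

definition poincare_flow ::
    "('v, 'b::metric_space, 'h::real_inner, 'a) vbundle
       \<Rightarrow> (real \<Rightarrow> 'v \<Rightarrow> 'v) \<Rightarrow> real \<Rightarrow> 'v \<times> real \<Rightarrow> 'v \<times> real" where
  "poincare_flow E \<Phi> t p =
     fib_scale (ext_bundle E) (1 / ext_norm E (ext_flow \<Phi> t p)) (ext_flow \<Phi> t p)"

definition poincare_proj ::
    "('v, 'b::metric_space, 'h::real_inner, 'a) vbundle \<Rightarrow> 'v \<Rightarrow> 'v \<times> real" where
  "poincare_proj E v = (fib_scale E (1 / ext_norm E (v, 1)) v, 1 / ext_norm E (v, 1))"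

end

theory Submission
  imports Defs
begin

text \<open>
  The equator is invariant and the open hemisphere is dense in the closed one, so the interior
  points of a chain between points of the open hemisphere can be moved off the equator. Hence
  (a) makes \<open>\<pi>\<^sub>P\<close> of the whole cone bundle chain transitive on the open hemisphere, and any half-line
  in it will do; \<open>M\<close> is nonempty because the compact sphere bundle contains an \<open>\<omega>\<close>-limit point.
  Conversely, a chain from \<open>x\<close> to \<open>y\<close> in the sphere bundle lifts, uniformly in \<open>\<rho> > 0\<close>, to a chain
  from \<open>\<pi>\<^sub>P (\<rho> x)\<close> to \<open>\<pi>\<^sub>P (c \<rho> y)\<close>, where the factor \<open>c > 0\<close> does not depend on \<open>\<rho>\<close>. Going from the
  cone down to the half-line through \<open>v0\<close>, along it, and back corrects the factors, and
  chain transitivity passes to the closure.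
\<close>


section \<open>Chains\<close>

text \<open>A single jump with both endpoints in \<open>X\<close>. Chains are its transitive
  closure, so they can be concatenated and treated by induction on the last jump instead of through
  indexed sequences.\<close>

definition chain_step ::
    "'x set \<Rightarrow> ('x \<Rightarrow> 'x \<Rightarrow> real) \<Rightarrow> (real \<Rightarrow> 'x \<Rightarrow> 'x) \<Rightarrow> real \<Rightarrow> real \<Rightarrow> 'x \<Rightarrow> 'x \<Rightarrow> bool" where
  "chain_step X d \<Psi> \<epsilon> T x y \<longleftrightarrow> x \<in> X \<and> y \<in> X \<and> (\<exists>t\<ge>T. d (\<Psi> t x) y < \<epsilon>)"

lemma is_chain_iff_tranclp: "is_chain X d \<Psi> \<epsilon> T = (chain_step X d \<Psi> \<epsilon> T)\<^sup>+\<^sup>+"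
proof (intro ext iffI)
  fix x y
  assume "is_chain X d \<Psi> \<epsilon> T x y"
  then obtain n \<tau> \<xi> where n: "n \<ge> (1::nat)" "\<xi> 0 = x" "\<xi> n = y" "\<forall>i\<le>n. \<xi> i \<in> X"
    "\<forall>i<n. \<tau> i \<ge> T \<and> d (\<Psi> (\<tau> i) (\<xi> i)) (\<xi> (Suc i)) < \<epsilon>"
    unfolding is_chain_def by blast
  then have step: "chain_step X d \<Psi> \<epsilon> T (\<xi> i) (\<xi> (Suc i))" if "i < n" for i
    using that unfolding chain_step_def by (metis Suc_leI less_imp_le)
  have "i < n \<Longrightarrow> (chain_step X d \<Psi> \<epsilon> T)\<^sup>+\<^sup>+ (\<xi> 0) (\<xi> (Suc i))" for i
  proof (induction i)
    case (Suc i)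
    then show ?case using step[of "Suc i"] by (meson Suc_lessD tranclp.trancl_into_trancl)
  qed (use step in blast)
  from this[of "n - 1"] show "(chain_step X d \<Psi> \<epsilon> T)\<^sup>+\<^sup>+ x y" using n by auto
next
  fix x y
  assume "(chain_step X d \<Psi> \<epsilon> T)\<^sup>+\<^sup>+ x y"
  then show "is_chain X d \<Psi> \<epsilon> T x y"
  proof (induction rule: tranclp_induct)
    case (base y)
    then obtain t where "t \<ge> T" "d (\<Psi> t x) y < \<epsilon>" "x \<in> X" "y \<in> X"
      unfolding chain_step_def by blast
    then show ?case unfolding is_chain_def
      by (intro exI[of _ 1] exI[of _ "\<lambda>_. t"] exI[of _ "\<lambda>i. if i = 0 then x else y"]) auto
  next
    case (step y z)
    from step.IH obtain n \<tau> \<xi> where n: "n \<ge> (1::nat)" "\<xi> 0 = x" "\<xi> n = y" "\<forall>i\<le>n. \<xi> i \<in> X"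
      "\<forall>i<n. \<tau> i \<ge> T \<and> d (\<Psi> (\<tau> i) (\<xi> i)) (\<xi> (Suc i)) < \<epsilon>"
      unfolding is_chain_def by blast
    from step.hyps obtain t where "t \<ge> T" "d (\<Psi> t y) z < \<epsilon>" "z \<in> X"
      unfolding chain_step_def by blast
    with n show ?case unfolding is_chain_def
      by (intro exI[of _ "Suc n"] exI[of _ "\<tau>(n := t)"] exI[of _ "\<xi>(Suc n := z)"])
        (auto simp: less_Suc_eq le_Suc_eq)
  qed
qed

lemma is_chain_trans:
  "is_chain X d \<Psi> \<epsilon> T x y \<Longrightarrow> is_chain X d \<Psi> \<epsilon> T y z \<Longrightarrow> is_chain X d \<Psi> \<epsilon> T x z"
  unfolding is_chain_iff_tranclp by (rule tranclp_trans)

lemma is_chain_single: "chain_step X d \<Psi> \<epsilon> T x y \<Longrightarrow> is_chain X d \<Psi> \<epsilon> T x y"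
  unfolding is_chain_iff_tranclp by blast

lemma is_chain_mono:
  assumes "is_chain X d \<Psi> \<epsilon> T x y" "X \<subseteq> X'" "\<epsilon> \<le> \<epsilon>'" "T' \<le> T"
  shows "is_chain X' d \<Psi> \<epsilon>' T' x y"
proof -
  have step: "chain_step X' d \<Psi> \<epsilon>' T' u v" if "chain_step X d \<Psi> \<epsilon> T u v" for u v
    using that assms(2-4) unfolding chain_step_def
    by (meson in_mono order_less_le_trans order_trans)
  from assms(1) show ?thesis unfolding is_chain_iff_tranclp
    by (induction rule: tranclp_induct) (auto dest: step intro: tranclp.trancl_into_trancl)
qed

lemma chain_transitiveD:
  "chain_transitive X d \<Psi> Y \<Longrightarrow> x \<in> Y \<Longrightarrow> y \<in> Y \<Longrightarrow> \<epsilon> > 0 \<Longrightarrow> T > 0 \<Longrightarrow> is_chain X d \<Psi> \<epsilon> T x y"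
  unfolding chain_transitive_def chain_limit_set_def by blast

lemma chain_transitiveI:
  assumes "Y \<subseteq> X"
    and "\<And>x y \<epsilon> T. x \<in> Y \<Longrightarrow> y \<in> Y \<Longrightarrow> \<epsilon> > 0 \<Longrightarrow> T > 0 \<Longrightarrow> is_chain X d \<Psi> \<epsilon> T x y"
  shows "chain_transitive X d \<Psi> Y"
  using assms unfolding chain_transitive_def chain_limit_set_def by blast

lemma chain_transitive_mono:
  assumes "chain_transitive X d \<Psi> Y" "X \<subseteq> X'"
  shows "chain_transitive X' d \<Psi> Y"
proof (rule chain_transitiveI)
  show "Y \<subseteq> X'" using assms unfolding chain_transitive_def by blast
  show "is_chain X' d \<Psi> \<epsilon> T x y" if "x \<in> Y" "y \<in> Y" "\<epsilon> > 0" "T > 0" for x y \<epsilon> T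
    using is_chain_mono[OF chain_transitiveD[OF assms(1) that] assms(2) order_refl order_refl] .
qed

lemma chain_transitive_subset:
  "chain_transitive X d \<Psi> Y \<Longrightarrow> Z \<subseteq> Y \<Longrightarrow> chain_transitive X d \<Psi> Z"
  unfolding chain_transitive_def by blast

section \<open>Chains for flows on a subspace with a compatible metric\<close>

locale compatible_flow =
  fixes P :: "'x::topological_space set" and d :: "'x \<Rightarrow> 'x \<Rightarrow> real" and \<Psi> :: "real \<Rightarrow> 'x \<Rightarrow> 'x"
  assumes compat: "compatible_metric P d"
    and flow_in: "x \<in> P \<Longrightarrow> \<Psi> t x \<in> P"
    and flow_add: "x \<in> P \<Longrightarrow> \<Psi> (s + t) x = \<Psi> s (\<Psi> t x)"
    and flow_cont: "continuous_on P (\<Psi> t)"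
begin

sublocale Metric_space P d
  using compat by (simp add: compatible_metric_def)

lemma topology_eq: "mtopology = top_of_set P"
  using compat by (simp add: compatible_metric_def)

text \<open>\<open>closure\<close> is taken in the ambient type, whereas \<open>d\<close> only
  metrizes \<open>P\<close>; compatibility turns a \<open>d\<close>-ball into the trace on
  \<open>P\<close> of an open set, which then meets \<open>Y\<close>.\<close>

lemma closure_approachable_metric:
  assumes "x \<in> P" "x \<in> closure Y" "Y \<subseteq> P" "e > 0"
  obtains y where "y \<in> Y" "d x y < e"
proof -
  have "openin (top_of_set P) (mball x e)"
    by (metis openin_mball topology_eq)
  then obtain W where W: "open W" "mball x e = P \<inter> W"
    by (auto simp: openin_open)
  have "x \<in> W" using W assms(1,4) centre_in_mball_iff by blast
  then obtain y where "y \<in> Y" "y \<in> W"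
    using assms(2) W(1) by (metis IntE closure_iff_nhds_not_empty subset_refl ex_in_conv)
  then show ?thesis using that[of y] assms(3) W(2) by (metis IntI in_mball subsetD)
qed

lemma flow_continuous_metric:
  assumes "x \<in> P" "e > 0"
  obtains \<delta> where "\<delta> > 0" "\<And>y. y \<in> P \<Longrightarrow> d x y < \<delta> \<Longrightarrow> d (\<Psi> t x) (\<Psi> t y) < e"
proof -
  have "continuous_map (top_of_set P) (top_of_set P) (\<Psi> t)"
    using flow_cont flow_in by (simp add: image_subset_iff)
  then have "continuous_map mtopology mtopology (\<Psi> t)"
    by (simp add: topology_eq)
  then show ?thesis using that assms metric_continuous_map[OF Metric_space_axioms]
    by metis
qed

text \<open>The jump inequalities are strict, so each interior point of the chain can be replaced by
  a nearby point of \<open>X\<close>: continuity of the flow for the given flight time controls the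
  move of the source, and the remaining slack the move of the target.\<close>

lemma is_chain_dense:
  assumes XP: "X' \<subseteq> P" "X \<subseteq> X'" and dense: "X' \<subseteq> closure X" 
    and x: "x \<in> X" and y: "y \<in> X" and c: "is_chain X' d \<Psi> \<epsilon> T x y"
  shows "is_chain X d \<Psi> \<epsilon> T x y"
proof -
  \<comment> \<open>A point that already lies in \<open>X\<close> is kept, which makes the new chain
    end exactly at \<open>y\<close>.\<close>
  have near: "\<exists>y'\<in>X. d y y' < \<eta> \<and> (y \<in> X \<longrightarrow> y' = y)" if "y \<in> X'" "\<eta> > 0" for y \<eta>
  proof (cases "y \<in> X")
    case True
    then show ?thesis using that XP by (intro bexI[of _ y]) auto
  next
    case False
    have "y \<in> P" "y \<in> closure X" "X \<subseteq> P" using that XP dense by auto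
    from closure_approachable_metric[OF this \<open>\<eta> > 0\<close>] False show ?thesis by metis
  qed
  have jump: "\<exists>z'\<in>X. d z z' < \<eta> \<and> (z \<in> X \<longrightarrow> z' = z) \<and> d w z' < \<epsilon>"
    if wz: "w \<in> P" "z \<in> X'" "d w z < \<epsilon>" "\<eta> > 0" for w z \<eta>
  proof -
    obtain z' where z': "z' \<in> X" "d z z' < min \<eta> (\<epsilon> - d w z)" "z \<in> X \<longrightarrow> z' = z"
      using near[of z "min \<eta> (\<epsilon> - d w z)"] wz by auto
    have "d w z' \<le> d w z + d z z'"
      by (rule triangle) (use wz z' XP in auto)
    then show ?thesis using z' by (intro bexI[of _ z']) auto
  qed
  have "(chain_step X' d \<Psi> \<epsilon> T)\<^sup>+\<^sup>+ x y" using c by (simp add: is_chain_iff_tranclp)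
  \<comment> \<open>The claim covers every \<open>\<eta>\<close>: the closeness
    \<open>\<delta>\<close> that the next jump demands depends on its flight time and slack, which
    are only known afterwards.\<close>
  then have "\<forall>\<eta>>0. \<exists>y'\<in>X. d y y' < \<eta> \<and> (y \<in> X \<longrightarrow> y' = y) \<and> is_chain X d \<Psi> \<epsilon> T x y'"
  proof (induction rule: tranclp_induct)
    case (base y)
    then obtain t where t: "y \<in> X'" "t \<ge> T" "d (\<Psi> t x) y < \<epsilon>"
      unfolding chain_step_def by blast
    have "is_chain X d \<Psi> \<epsilon> T x z" if "z \<in> X" "d (\<Psi> t x) z < \<epsilon>" for z
      using that t(2) x by (intro is_chain_single) (auto simp: chain_step_def)
    moreover have "\<Psi> t x \<in> P" using flow_in x XP by blast
    ultimately show ?case using jump[OF _ t(1,3)] by blast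
  next
    case (step y z)
    then obtain t where t: "y \<in> X'" "z \<in> X'" "t \<ge> T" "d (\<Psi> t y) z < \<epsilon>"
      unfolding chain_step_def by blast
    have yP: "y \<in> P" "z \<in> P" using t XP by auto
    obtain \<delta> where \<delta>: "\<delta> > 0" "\<And>y'. y' \<in> P \<Longrightarrow> d y y' < \<delta> \<Longrightarrow> d (\<Psi> t y) (\<Psi> t y') < \<epsilon> - d (\<Psi> t y) z"
      using flow_continuous_metric[OF yP(1), of "\<epsilon> - d (\<Psi> t y) z"] t by auto
    obtain y' where y': "y' \<in> X" "d y y' < \<delta>" "is_chain X d \<Psi> \<epsilon> T x y'"
      using step.IH \<delta>(1) by blast
    have y'P: "y' \<in> P" using y' XP by auto
    have "d (\<Psi> t y') z \<le> d (\<Psi> t y') (\<Psi> t y) + d (\<Psi> t y) z"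
      by (rule triangle) (use flow_in y'P yP in auto)
    then have lt: "d (\<Psi> t y') z < \<epsilon>"
      using \<delta>(2)[OF y'P y'(2)] commute[of "\<Psi> t y"] by simp
    show ?case
    proof (intro allI impI)
      fix \<eta> :: real assume "\<eta> > 0"
      then obtain z' where z': "z' \<in> X" "d z z' < \<eta>" "z \<in> X \<longrightarrow> z' = z" "d (\<Psi> t y') z' < \<epsilon>"
        using jump[OF flow_in[OF y'P] t(2) lt] by blast
      then have "is_chain X d \<Psi> \<epsilon> T y' z'"
        using y'(1) t(3) by (intro is_chain_single) (auto simp: chain_step_def)
      with y'(3) have "is_chain X d \<Psi> \<epsilon> T x z'" by (rule is_chain_trans)
      then show "\<exists>z'\<in>X. d z z' < \<eta> \<and> (z \<in> X \<longrightarrow> z' = z) \<and> is_chain X d \<Psi> \<epsilon> T x z'"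
        using z'(1-3) by (intro bexI[of _ z']) simp_all
    qed
  qed
  then show ?thesis using y by (metis zero_less_one)
qed

text \<open>Replace the ends \<open>x\<close>, \<open>y\<close> by nearby \<open>x'\<close>,
  \<open>y'\<close> in \<open>Y\<close>. A first jump leads from \<open>x\<close> to
  \<open>\<Psi> T x'\<close>, where the chain from \<open>x'\<close> to \<open>y'\<close> is joined;
  its last jump is redirected from \<open>y'\<close> to \<open>y\<close>.\<close>

lemma chain_transitive_closure:
  assumes XP: "X \<subseteq> P" and inv: "\<And>t x. x \<in> X \<Longrightarrow> \<Psi> t x \<in> X"
    and cl: "closure Y \<subseteq> X" and Y: "chain_transitive X d \<Psi> Y"
  shows "chain_transitive X d \<Psi> (closure Y)"
proof (rule chain_transitiveI[OF cl])
  fix x y and \<epsilon> T :: real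
  assume xy: "x \<in> closure Y" "y \<in> closure Y" and pos: "\<epsilon> > 0" "T > 0"
  have YX: "Y \<subseteq> X" using Y by (simp add: chain_transitive_def)
  have P: "x \<in> P" "y \<in> P" "Y \<subseteq> P" using xy cl YX XP by auto
  obtain \<delta> where \<delta>: "\<delta> > 0" "\<And>x'. x' \<in> P \<Longrightarrow> d x x' < \<delta> \<Longrightarrow> d (\<Psi> T x) (\<Psi> T x') < \<epsilon>"
    using flow_continuous_metric[OF P(1) pos(1)] by metis
  obtain x' where x': "x' \<in> Y" "d x x' < \<delta>"
    using closure_approachable_metric[OF P(1) xy(1) P(3) \<delta>(1)] by blast
  obtain y' where y': "y' \<in> Y" "d y y' < \<epsilon> / 2"
    using closure_approachable_metric[OF P(2) xy(2) P(3), of "\<epsilon> / 2"] pos by auto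
  have first: "is_chain X d \<Psi> \<epsilon> T x (\<Psi> T x')"
    using \<delta>(2)[of x'] x' YX XP inv cl xy
    by (intro is_chain_single) (auto simp: chain_step_def)
  \<comment> \<open>The doubled time lets the first flight lose its initial segment of length
    \<open>T\<close>; the halved error leaves room to redirect the last jump.\<close>
  have "is_chain X d \<Psi> (\<epsilon> / 2) (2 * T) x' y'"
    using chain_transitiveD[OF Y x'(1) y'(1)] pos by simp
  then obtain z where z: "chain_step X d \<Psi> (\<epsilon> / 2) (2 * T) x' z"
    and zy: "(chain_step X d \<Psi> (\<epsilon> / 2) (2 * T))\<^sup>*\<^sup>* z y'"
    unfolding is_chain_iff_tranclp by (meson tranclpD)
  have "chain_step X d \<Psi> (\<epsilon> / 2) T (\<Psi> T x') z"
  proof -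
    obtain t where t: "t \<ge> 2 * T" "d (\<Psi> t x') z < \<epsilon> / 2"
      using z unfolding chain_step_def by blast
    have "\<Psi> t x' = \<Psi> (t - T) (\<Psi> T x')"
      using flow_add[of x' "t - T" T] x' P by auto
    moreover have "T \<le> t - T" using t by simp
    ultimately show ?thesis using t z inv unfolding chain_step_def by metis
  qed
  then have "is_chain X d \<Psi> (\<epsilon> / 2) T (\<Psi> T x') z" by (rule is_chain_single)
  \<comment> \<open>The chain may consist of its first jump alone; then \<open>z\<close> is already
    \<open>y'\<close>.\<close>
  moreover have "z = y' \<or> is_chain X d \<Psi> (\<epsilon> / 2) T z y'"
    using zy pos is_chain_mono[of X d \<Psi> "\<epsilon> / 2" "2 * T" z y' X "\<epsilon> / 2" T]
    unfolding is_chain_iff_tranclp by (auto dest: rtranclpD)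
  ultimately have "is_chain X d \<Psi> (\<epsilon> / 2) T (\<Psi> T x') y'"
    using is_chain_trans by metis
  then obtain u where u: "u = \<Psi> T x' \<or> is_chain X d \<Psi> (\<epsilon> / 2) T (\<Psi> T x') u"
    "chain_step X d \<Psi> (\<epsilon> / 2) T u y'"
    unfolding is_chain_iff_tranclp by (metis tranclp.cases)
  have "chain_step X d \<Psi> \<epsilon> T u y"
  proof -
    obtain t where t: "t \<ge> T" "d (\<Psi> t u) y' < \<epsilon> / 2"
      using u(2) unfolding chain_step_def by blast
    have "u \<in> X" using u(2) by (simp add: chain_step_def)
    then have "d (\<Psi> t u) y \<le> d (\<Psi> t u) y' + d y' y"
      by (intro triangle) (use XP inv y' P in auto)
    then have "d (\<Psi> t u) y < \<epsilon>" using t y' commute[of y y'] by simp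
    then show ?thesis using \<open>u \<in> X\<close> t xy cl unfolding chain_step_def by blast
  qed
  then have "is_chain X d \<Psi> \<epsilon> T u y" by (rule is_chain_single)
  moreover have "\<Psi> T x' = u \<or> is_chain X d \<Psi> \<epsilon> T (\<Psi> T x') u"
    using u(1) pos is_chain_mono[of X d \<Psi> "\<epsilon> / 2" T "\<Psi> T x'" u X \<epsilon> T] by auto
  ultimately show "is_chain X d \<Psi> \<epsilon> T x y"
    using first is_chain_trans by metis
qed

text \<open>Any \<open>\<omega>\<close>-limit point is chain recurrent.\<close>

lemma chain_recurrent_component_nonempty:
  assumes "compact P" "P \<noteq> {}" "chain_recurrent_component P d \<Psi> M"
  shows "M \<noteq> {}"
proof
  assume "M = {}"
  obtain x where x: "x \<in> P" using assms(2) by blast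
  have "compact_space mtopology"
    using assms(1) by (simp add: topology_eq compact_space_subtopology)
  moreover have "range (\<lambda>n. \<Psi> (real n) x) \<subseteq> P" using flow_in[OF x] by auto
  ultimately obtain y r where y: "y \<in> P" "strict_mono r"
    "limitin mtopology ((\<lambda>n. \<Psi> (real n) x) \<circ> r) y sequentially"
    unfolding compact_space_sequentially by blast
  have ev: "\<forall>\<^sub>F n in sequentially. d (\<Psi> (real (r n)) x) y < e" if "e > 0" for e
    using y(3) that by (auto simp: limitin_metric elim: eventually_mono)
  have "is_chain P d \<Psi> \<epsilon> T y y" if pos: "\<epsilon> > 0" "T > 0" for \<epsilon> T
  proof -
    obtain \<delta> where \<delta>: "\<delta> > 0" "\<And>y'. y' \<in> P \<Longrightarrow> d y y' < \<delta> \<Longrightarrow> d (\<Psi> T y) (\<Psi> T y') < \<epsilon>"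
      using flow_continuous_metric[OF y(1) pos(1)] by metis
    obtain n where n: "d (\<Psi> (real (r n)) x) y < \<delta>"
      using ev[OF \<delta>(1)] by (auto simp: eventually_sequentially)
    obtain N where N: "\<And>m. m \<ge> N \<Longrightarrow> d (\<Psi> (real (r m)) x) y < \<epsilon>"
      using ev[OF pos(1)] by (auto simp: eventually_sequentially)
    \<comment> \<open>The summand \<open>N\<close> brings the orbit back near \<open>y\<close>;
      since \<open>r m \<ge> m\<close>, at least time \<open>T\<close> is left after
      \<open>r n + T\<close>, when the orbit passes \<open>z\<close>.\<close>
    define m where "m = N + nat \<lceil>real (r n) + 2 * T\<rceil>"
    have "real (r n) + 2 * T \<le> real m" unfolding m_def by linarith
    also have "\<dots> \<le> real (r m)" using seq_suble[OF y(2)] by simp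
    finally have rm: "real (r m) - real (r n) - T \<ge> T" by simp
    \<comment> \<open>The chain runs from \<open>y\<close> to \<open>z\<close> by continuity of
      \<open>\<Psi> T\<close>, and then back to \<open>y\<close> along the orbit of
      \<open>x\<close>, to which \<open>z\<close> belongs.\<close>
    define z where "z = \<Psi> T (\<Psi> (real (r n)) x)"
    have z: "z \<in> P" unfolding z_def using flow_in x by blast
    have "z = \<Psi> (T + real (r n)) x" unfolding z_def using flow_add[OF x] by simp
    then have "\<Psi> (real (r m) - real (r n) - T) z = \<Psi> (real (r m)) x"
      using flow_add[OF x, of "real (r m) - real (r n) - T" "T + real (r n)"] by simp
    then have "is_chain P d \<Psi> \<epsilon> T z y"
      using rm N[of m] z y(1) unfolding m_def
      by (intro is_chain_single) (metis chain_step_def le_add1)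
    moreover have "is_chain P d \<Psi> \<epsilon> T y z"
      using \<delta>(2)[OF flow_in[OF x], of "real (r n)"] n z y(1) commute[of y] 
      by (intro is_chain_single) (auto simp: chain_step_def z_def)
    ultimately show ?thesis using is_chain_trans by metis
  qed
  then have "chain_transitive P d \<Psi> {y}" using y(1) by (intro chain_transitiveI) auto
  \<comment> \<open>The empty set is properly contained in \<open>{y}\<close>, hence not
    maximal.\<close>
  with assms(3) \<open>M = {}\<close> show False unfolding chain_recurrent_component_def by blast
qed

end

section \<open>Vector bundles and their sphere bundles\<close>

locale vector_bundle_locale =
  fixes E :: "('v::topological_space, 'b::metric_space, 'h::euclidean_space, 'a) vbundle"
  assumes vb: "vector_bundle E"
begin

abbreviation "I \<equiv> bindex E"
abbreviation "U \<equiv> bcover E"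
abbreviation "proj \<equiv> bproj E"
abbreviation "V \<equiv> part_over E"
abbreviation "coord a v \<equiv> snd (btriv E a v)"
abbreviation "scl \<equiv> fib_scale E"
abbreviation "nrm \<equiv> fib_norm E"
abbreviation "SV \<equiv> sphere_bundle E"
abbreviation "weight \<equiv> cover_weight E"

section \<open>Trivializations\<close>

lemma compact_base: "compact (UNIV :: 'b set)"
  and continuous_proj_UNIV: "continuous_on UNIV proj"
  and finite_index: "finite I"
  and open_cover: "a \<in> I \<Longrightarrow> open (U a)"
  and cover_UNIV: "(\<Union>a\<in>I. U a) = UNIV"
  using vb unfolding vector_bundle_def by blast+

lemma continuous_proj: "continuous_on S proj"
  using continuous_proj_UNIV continuous_on_subset by blast

text \<open>The bundle axioms provide some inverse \<open>g\<close>; injectivity of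
  \<open>btriv E a\<close> identifies it with the \<open>inv_into\<close> inverse through which the
  fiber operations are defined.\<close>

lemma homeomorphism_triv:
  assumes "a \<in> I"
  shows "homeomorphism (V a) (U a \<times> UNIV) (btriv E a) (triv_inv E a)"
proof -
  obtain g where g: "homeomorphism (V a) (U a \<times> UNIV) (btriv E a) g"
    using vb assms unfolding vector_bundle_def by blast
  have inj: "inj_on (btriv E a) (V a)"
    by (rule inj_on_inverseI) (rule homeomorphism_apply1[OF g])
  have "triv_inv E a y = g y" if "y \<in> U a \<times> UNIV" for y
    unfolding triv_inv_def
    using inv_into_f_eq[OF inj] homeomorphism_image2[OF g] homeomorphism_apply2[OF g that] that
    by blast
  then show ?thesis by (rule homeomorphism_cong[OF g refl refl refl])
qed

lemma triv_eq:
  assumes "a \<in> I" "v \<in> V a"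
  shows "btriv E a v = (proj v, coord a v)"
proof -
  have "fst (btriv E a v) = proj v"
    using vb assms unfolding vector_bundle_def by blast
  then show ?thesis by (metis prod.collapse)
qed

lemma mem_part_over [simp]: "v \<in> V a \<longleftrightarrow> proj v \<in> U a"
  by (simp add: part_over_def)

lemma triv_inv_mem:
  assumes "a \<in> I" "b \<in> U a"
  shows "triv_inv E a (b, x) \<in> V a"
  unfolding homeomorphism_image2[OF homeomorphism_triv[OF assms(1)], symmetric]
  using assms(2) by blast

lemma triv_triv_inv: "a \<in> I \<Longrightarrow> b \<in> U a \<Longrightarrow> btriv E a (triv_inv E a (b, x)) = (b, x)"
  by (simp add: homeomorphism_apply2[OF homeomorphism_triv])

lemma proj_triv_inv: "a \<in> I \<Longrightarrow> b \<in> U a \<Longrightarrow> proj (triv_inv E a (b, x)) = b"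
  using triv_eq[OF _ triv_inv_mem[of a b x]] triv_triv_inv[of a b x] by simp

lemma triv_inv_triv: "a \<in> I \<Longrightarrow> v \<in> V a \<Longrightarrow> triv_inv E a (proj v, coord a v) = v"
  using homeomorphism_apply1[OF homeomorphism_triv, of a v] triv_eq[of a v] by simp

lemma continuous_triv_inv: "a \<in> I \<Longrightarrow> continuous_on (U a \<times> UNIV) (triv_inv E a)"
  by (rule homeomorphism_cont2[OF homeomorphism_triv])

lemma continuous_coord: "a \<in> I \<Longrightarrow> continuous_on (V a) (coord a)"
  by (rule continuous_on_snd[OF homeomorphism_cont1[OF homeomorphism_triv]])

lemma open_part_over: "a \<in> I \<Longrightarrow> open (V a)"
  using open_vimage[OF open_cover continuous_proj] by (simp add: part_over_def)

section \<open>Scalar multiplication in the fibers\<close>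

lemma index_at: "index_at E b \<in> I" "b \<in> U (index_at E b)"
proof -
  have "\<exists>a. a \<in> I \<and> b \<in> U a" using cover_UNIV by blast
  then show "index_at E b \<in> I" "b \<in> U (index_at E b)"
    unfolding index_at_def by (metis (mono_tags, lifting) someI_ex)+
qed

text \<open>Linearity of the transition maps makes the result independent of the chart that
  \<open>index_at\<close> selects, so scalar multiples can be computed in any chart around the base
  point.\<close>

lemma fib_scale_eq:
  assumes a: "a \<in> I" "v \<in> V a"
  shows "scl c v = triv_inv E a (proj v, c *\<^sub>R coord a v)"
proof -
  define a' where "a' = index_at E (proj v)"
  have a': "a' \<in> I" "v \<in> V a'" using index_at[of "proj v"] by (auto simp: a'_def)
  let ?w = "triv_inv E a' (proj v, c *\<^sub>R coord a' v)"
  have w: "proj ?w = proj v" using a' by (simp add: proj_triv_inv)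
  have "linear (transition E a a' (proj v))"
    using vb a a' unfolding vector_bundle_def mem_part_over by blast
  then have "coord a ?w = c *\<^sub>R coord a (triv_inv E a' (proj v, coord a' v))"
    by (metis linear_scale transition_def)
  then have "coord a ?w = c *\<^sub>R coord a v" using a' by (simp add: triv_inv_triv)
  then have "?w = triv_inv E a (proj v, c *\<^sub>R coord a v)"
    using triv_inv_triv[of a ?w] a w by simp
  then show ?thesis by (simp add: fib_scale_def Let_def a'_def)
qed

lemma proj_scl [simp]: "proj (scl c v) = proj v"
  using fib_scale_eq[of "index_at E (proj v)" v] index_at[of "proj v"] by (simp add: proj_triv_inv)

lemma coord_scale: "a \<in> I \<Longrightarrow> v \<in> V a \<Longrightarrow> coord a (scl c v) = c *\<^sub>R coord a v"
  using fib_scale_eq triv_triv_inv by simp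

lemma scale_scale [simp]: "scl c (scl e v) = scl (c * e) v"
proof -
  let ?a = "index_at E (proj v)"
  have "?a \<in> I" "v \<in> V ?a" "scl e v \<in> V ?a" using index_at[of "proj v"] by auto
  then show ?thesis by (simp add: fib_scale_eq[of ?a] triv_triv_inv proj_triv_inv)
qed

lemma scale_one [simp]: "scl 1 v = v"
  using fib_scale_eq[of "index_at E (proj v)" v] index_at[of "proj v"] triv_inv_triv by simp

text \<open>In a chart the map only multiplies the coordinate by \<open>c\<close>; the open sets
  \<open>UNIV \<times> V a\<close> cover everything, so continuity on each of them suffices.\<close>

lemma continuous_scale: "continuous_on S (\<lambda>(c, v). scl c v)"
proof -
  have "continuous_on (UNIV \<times> V a) (\<lambda>(c, v). scl c v)" if a: "a \<in> I" for a
  proof -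
    have "continuous_on (UNIV \<times> V a) (\<lambda>p. (proj (snd p), fst p *\<^sub>R coord a (snd p)))"
      by (intro continuous_intros continuous_on_compose2[OF continuous_proj]
          continuous_on_compose2[OF continuous_coord[OF a]]) auto
    then have "continuous_on (UNIV \<times> V a)
        (\<lambda>p. triv_inv E a (proj (snd p), fst p *\<^sub>R coord a (snd p)))"
      by (rule continuous_on_compose2[OF continuous_triv_inv[OF a]]) auto
    then show ?thesis
      by (rule continuous_on_eq) (use a fib_scale_eq in auto)
  qed
  then have "continuous_on (\<Union>a\<in>I. UNIV \<times> V a) (\<lambda>(c, v). scl c v)"
    by (intro continuous_on_open_UN) (auto intro: open_Times open_part_over)
  moreover have "(\<Union>a\<in>I. UNIV \<times> V a) = UNIV"
    using cover_UNIV by (auto simp: set_eq_iff)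
  ultimately show ?thesis using continuous_on_subset by (metis subset_UNIV)
qed

lemma continuous_on_fib_scale [continuous_intros]:
  "continuous_on S f \<Longrightarrow> continuous_on S g \<Longrightarrow> continuous_on S (\<lambda>x. scl (f x) (g x))"
  using continuous_on_compose2[OF continuous_scale[of UNIV], of S "\<lambda>x. (f x, g x)"]
  by (auto intro: continuous_on_Pair)

section \<open>Weights and the fiber norm\<close>

lemma weight_nonneg: "weight a b \<ge> 0"
  by (simp add: cover_weight_def infdist_nonneg)

text \<open>The complement of \<open>U a\<close> is closed, so only its own points have distance 0
  to it; for \<open>U a = UNIV\<close> the weight is 1 by convention.\<close>

lemma weight_pos_iff: "a \<in> I \<Longrightarrow> weight a b > 0 \<longleftrightarrow> b \<in> U a"
  using in_closed_iff_infdist_zero[of "- U a" b] open_cover[of a] infdist_nonneg[of b "- U a"]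
  by (auto simp: cover_weight_def less_le)

lemma weight_outside: "a \<in> I \<Longrightarrow> b \<notin> U a \<Longrightarrow> weight a b = 0"
  using weight_pos_iff weight_nonneg by (metis less_le)

lemma continuous_weight: "continuous_on S (weight a)"
  unfolding cover_weight_def by (cases "U a = UNIV") (auto intro!: continuous_intros)

lemma fib_inner_self: "fib_inner E v v = (\<Sum>a\<in>I. weight a (proj v) * (norm (coord a v))\<^sup>2)"
  by (simp add: fib_inner_def power2_norm_eq_inner)

lemma nrm_sq: "(nrm v)\<^sup>2 = (\<Sum>a\<in>I. weight a (proj v) * (norm (coord a v))\<^sup>2)"
  unfolding fib_norm_def fib_inner_self[symmetric]
  by (simp add: fib_inner_self sum_nonneg weight_nonneg)

lemma nrm_nonneg [simp]: "nrm v \<ge> 0"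
  unfolding fib_norm_def by (simp add: fib_inner_self sum_nonneg weight_nonneg)

lemma nrm_scale [simp]: "nrm (scl c v) = \<bar>c\<bar> * nrm v"
proof -
  have "weight a (proj v) * (norm (coord a (scl c v)))\<^sup>2
      = c\<^sup>2 * (weight a (proj v) * (norm (coord a v))\<^sup>2)" if "a \<in> I" for a
    \<comment> \<open>Outside \<open>U a\<close> the value \<open>coord a v\<close> is arbitrary,
      but its weight vanishes.\<close>
    using that by (cases "proj v \<in> U a")
      (auto simp: coord_scale weight_outside power_mult_distrib)
  then have "(nrm (scl c v))\<^sup>2 = (\<bar>c\<bar> * nrm v)\<^sup>2"
    unfolding nrm_sq power_mult_distrib power2_abs proj_scl sum_distrib_left
    by (intro sum.cong refl)
  then show ?thesis by (simp add: power2_eq_iff_nonneg)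
qed

lemma nrm_eq_0_iff: "nrm v = 0 \<longleftrightarrow> (\<forall>a\<in>I. proj v \<in> U a \<longrightarrow> coord a v = 0)"
proof -
  have "nrm v = 0 \<longleftrightarrow> (nrm v)\<^sup>2 = 0" by simp
  also have "\<dots> \<longleftrightarrow> (\<forall>a\<in>I. weight a (proj v) * (norm (coord a v))\<^sup>2 = 0)"
    unfolding nrm_sq by (rule sum_nonneg_eq_0_iff) (auto simp: finite_index weight_nonneg)
  also have "\<dots> \<longleftrightarrow> (\<forall>a\<in>I. proj v \<in> U a \<longrightarrow> coord a v = 0)"
  proof (intro ball_cong refl)
    fix a assume "a \<in> I"
    then show "weight a (proj v) * (norm (coord a v))\<^sup>2 = 0 \<longleftrightarrow> (proj v \<in> U a \<longrightarrow> coord a v = 0)"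
      using weight_pos_iff[of a "proj v"] weight_outside[of a "proj v"] by auto
  qed
  finally show ?thesis .
qed

text \<open>Describes zero vectors through \<open>scl\<close> alone, so that a flow commuting with
  \<open>scl\<close> visibly preserves them.\<close>

lemma scl_0_eq_iff: "scl 0 v = v \<longleftrightarrow> nrm v = 0"
proof
  assume "scl 0 v = v"
  then show "nrm v = 0" using nrm_scale[of 0 v] by simp
next
  assume "nrm v = 0"
  then show "scl 0 v = v"
    using fib_scale_eq[of "index_at E (proj v)" v 0] index_at[of "proj v"]
      triv_inv_triv[of "index_at E (proj v)" v] nrm_eq_0_iff by simp
qed

text \<open>Each summand is continuous on \<open>closure (V a)\<close>, where the extended
  trivialization can stand in for \<open>btriv\<close> because the weight vanishes on the boundary,
  and it is 0 on the closed complement of \<open>V a\<close>. The two closed pieces are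
  glued.\<close>

lemma continuous_nrm: "continuous_on S nrm"
proof -
  have "continuous_on UNIV (\<lambda>v. weight a (proj v) * (norm (coord a v))\<^sup>2)" (is "continuous_on _ ?q")
    if a: "a \<in> I" for a
  proof -
    obtain f g where fg: "homeomorphism (closure (V a)) (closure (U a) \<times> UNIV) f g"
      "\<forall>v\<in>V a. f v = btriv E a v"
      using vb a unfolding vector_bundle_def by blast
    have "continuous_on (closure (V a)) (\<lambda>v. weight a (proj v) * (norm (snd (f v)))\<^sup>2)"
      by (intro continuous_intros continuous_on_compose2[OF continuous_weight continuous_proj] 
          homeomorphism_cont1[OF fg(1)]) auto
    then have 1: "continuous_on (closure (V a)) ?q"
    proof (rule continuous_on_eq)
      fix x
      show "weight a (proj x) * (norm (snd (f x)))\<^sup>2 = weight a (proj x) * (norm (coord a x))\<^sup>2"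
        using fg(2) weight_outside[OF a, of "proj x"] by (cases "x \<in> V a") auto
    qed
    have 2: "continuous_on (- V a) ?q"
      by (rule continuous_on_eq[of _ "\<lambda>_. 0"]) (use a in \<open>auto simp: weight_outside\<close>)
    have "continuous_on (closure (V a) \<union> - V a) ?q"
      using 1 2 open_part_over[OF a] by (intro continuous_on_closed_Un) auto
    moreover have "closure (V a) \<union> - V a = UNIV" using closure_subset[of "V a"] by blast
    ultimately show ?thesis by simp
  qed
  then have "continuous_on UNIV (\<lambda>v. sqrt (\<Sum>a\<in>I. weight a (proj v) * (norm (coord a v))\<^sup>2))"
    by (intro continuous_on_real_sqrt continuous_on_sum)
  moreover have "nrm = (\<lambda>v. sqrt (\<Sum>a\<in>I. weight a (proj v) * (norm (coord a v))\<^sup>2))"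
    by (simp add: fun_eq_iff fib_norm_def fib_inner_self)
  ultimately have "continuous_on UNIV nrm" by simp
  then show ?thesis using continuous_on_subset by blast
qed

lemma continuous_on_fib_norm [continuous_intros]:
  "continuous_on S f \<Longrightarrow> continuous_on S (\<lambda>x. nrm (f x))"
  by (rule continuous_on_compose2[OF continuous_nrm[of UNIV]]) auto

section \<open>Compactness of the sphere bundle\<close>

lemma mem_sphere [simp]: "v \<in> SV \<longleftrightarrow> nrm v = 1"
  by (simp add: sphere_bundle_def)

lemma sphere_nonempty: "SV \<noteq> {}"
proof -
  obtain h :: 'h where h: "h \<noteq> 0" using nonempty_Basis nonzero_Basis by blast
  obtain b :: 'b where True by blast
  define v where "v = triv_inv E (index_at E b) (b, h)"
  have "proj v = b" "coord (index_at E b) v = h"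
    unfolding v_def using index_at by (auto simp: proj_triv_inv triv_triv_inv)
  then have "nrm v \<noteq> 0" using nrm_eq_0_iff[of v] index_at[of b] h by auto
  then have "scl (1 / nrm v) v \<in> SV" by simp
  then show ?thesis by blast
qed

text \<open>The sum of the weights is continuous and positive on the compact base, hence has a
  positive minimum; over each point some weight is at least the average.\<close>

lemma weight_lower_bound: "\<exists>\<delta>>0. \<forall>b. \<exists>a\<in>I. weight a b \<ge> \<delta>"
proof -
  let ?W = "\<lambda>b. \<Sum>a\<in>I. weight a b"
  have "continuous_on UNIV ?W" by (intro continuous_intros continuous_weight)
  then obtain b0 where b0: "\<And>b. ?W b0 \<le> ?W b"
    using continuous_attains_inf[OF compact_base, of ?W] by auto
  have "weight (index_at E b0) b0 > 0" using index_at weight_pos_iff by blast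
  then have pos: "?W b0 > 0"
    using sum_pos2[OF finite_index, of "index_at E b0" "\<lambda>a. weight a b0"] index_at weight_nonneg
    by blast
  then have cI: "card I > 0" using finite_index by (auto simp: card_gt_0_iff)
  have "\<exists>a\<in>I. weight a b \<ge> ?W b0 / card I" for b
  proof (rule ccontr)
    assume "\<not> ?thesis"
    then have "?W b < of_nat (card I) * (?W b0 / card I)"
      using cI by (intro sum_bounded_above_strict) (auto simp: not_le)
    then show False using b0[of b] cI by simp
  qed
  then show ?thesis using pos cI by (intro exI[of _ "?W b0 / card I"]) auto
qed

text \<open>Where the weight of a chart is at least \<open>\<delta>\<close>, a unit vector has
  coordinate norm at most \<open>sqrt (1 / \<delta>)\<close>. So the closed set \<open>SV\<close>
  lies in a finite union of compact chart images.\<close>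

lemma compact_sphere: "compact SV"
proof -
  obtain \<delta> where \<delta>: "\<delta> > 0" "\<And>b. \<exists>a\<in>I. weight a b \<ge> \<delta>" using weight_lower_bound by blast
  \<comment> \<open>\<open>U a\<close> need not be compact; this superlevel set of the weight is,
    and it is contained in \<open>U a\<close>.\<close>
  define K where "K a = {b. weight a b \<ge> \<delta>}" for a
  define R where "R = sqrt (1 / \<delta>)"
  define C where "C = (\<Union>a\<in>I. triv_inv E a ` (K a \<times> cball (0::'h) R))"
  have "compact (triv_inv E a ` (K a \<times> cball (0::'h) R))" if a: "a \<in> I" for a
  proof (rule compact_continuous_image)
    have "K a \<subseteq> U a" using weight_outside[OF a] \<delta>(1) unfolding K_def by force
    then show "continuous_on (K a \<times> cball (0::'h) R) (triv_inv E a)"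
      using continuous_on_subset[OF continuous_triv_inv[OF a]] by blast
    have "closed (K a)"
      unfolding K_def by (intro closed_Collect_le continuous_intros continuous_weight)
    then have "compact (K a)" using compact_Int_closed[OF compact_base] by simp
    then show "compact (K a \<times> cball (0::'h) R)" by (intro compact_Times) auto
  qed
  then have "compact C" unfolding C_def using finite_index by (intro compact_UN) auto
  moreover have "closed SV"
    unfolding sphere_bundle_def by (intro closed_Collect_eq continuous_intros)
  ultimately have "compact (C \<inter> SV)" by (rule compact_Int_closed)
  moreover have "SV \<subseteq> C"
  proof
    fix v assume v: "v \<in> SV"
    obtain a where a: "a \<in> I" "weight a (proj v) \<ge> \<delta>" using \<delta> by blast
    then have "weight a (proj v) > 0" using \<delta>(1) by simp
    then have "proj v \<in> U a" using weight_pos_iff a by blast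
    have "\<delta> * (norm (coord a v))\<^sup>2 \<le> weight a (proj v) * (norm (coord a v))\<^sup>2"
      using a by (intro mult_right_mono) auto
    also have "\<dots> \<le> (nrm v)\<^sup>2"
      unfolding nrm_sq using a finite_index by (intro member_le_sum) (auto simp: weight_nonneg)
    finally have "(norm (coord a v))\<^sup>2 \<le> 1 / \<delta>"
      using v \<delta>(1) by (simp add: field_simps)
    then have "norm (coord a v) \<le> R" unfolding R_def by (rule real_le_rsqrt)
    then have "(proj v, coord a v) \<in> K a \<times> cball (0::'h) R" using a by (simp add: K_def)
    moreover have "v = triv_inv E a (proj v, coord a v)"
      using triv_inv_triv a \<open>proj v \<in> U a\<close> by simp
    ultimately show "v \<in> C" unfolding C_def using a(1) by blast
  qed
  ultimately show ?thesis by (simp add: inf_absorb2)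
qed

section \<open>The bundle extended by a real coordinate\<close>

lemma index_at_ext [simp]: "index_at (ext_bundle E) b = index_at E b"
  by (simp add: index_at_def ext_bundle_def)

text \<open>The scalar multiple in \<open>ext_bundle E\<close> is an \<open>inv_into\<close> value
  of the extended chart. That chart is injective, so it suffices to exhibit a preimage.\<close>

lemma ext_scale: "fib_scale (ext_bundle E) c (v, r) = (scl c v, c * r)"
proof -
  define a where "a = index_at E (proj v)"
  have a: "a \<in> I" "proj v \<in> U a" using index_at by (auto simp: a_def)
  have inj: "inj_on (btriv (ext_bundle E) a) (part_over (ext_bundle E) a)"
  proof (rule inj_onI; clarify)
    fix w s w' s'
    assume "(w, s) \<in> part_over (ext_bundle E) a" "(w', s') \<in> part_over (ext_bundle E) a"
      and eq: "btriv (ext_bundle E) a (w, s) = btriv (ext_bundle E) a (w', s')"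
    then have "w \<in> V a" "w' \<in> V a" by (auto simp: part_over_def ext_bundle_def)
    moreover have "btriv E a w = btriv E a w'" "s = s'"
      using eq by (auto simp: ext_bundle_def prod_eq_iff)
    ultimately show "w = w' \<and> s = s'" using triv_inv_triv[OF a(1)] triv_eq[OF a(1)] by metis
  qed
  let ?w = "triv_inv E a (proj v, c *\<^sub>R coord a v)"
  have "triv_inv (ext_bundle E) a (proj v, c *\<^sub>R (coord a v, r)) = (?w, c * r)"
    unfolding triv_inv_def[of "ext_bundle E"]
    by (rule inv_into_f_eq[OF inj])
      (use a in \<open>auto simp: part_over_def ext_bundle_def proj_triv_inv triv_triv_inv\<close>)
  moreover have "scl c v = ?w" using a fib_scale_eq by simp
  moreover have "fib_scale (ext_bundle E) c (v, r)
      = triv_inv (ext_bundle E) a (proj v, c *\<^sub>R (coord a v, r))"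
    unfolding fib_scale_def Let_def a_def by (simp add: index_at_ext) (simp add: ext_bundle_def)
  ultimately show ?thesis by simp
qed

end

section \<open>Linear flows\<close>

locale linear_flow_locale = vector_bundle_locale E
  for E :: "('v::topological_space, 'b::metric_space, 'h::euclidean_space, 'a) vbundle" +
  fixes \<Phi> :: "real \<Rightarrow> 'v \<Rightarrow> 'v"
  assumes lf: "linear_flow E \<Phi>"
begin

abbreviation "xnrm \<equiv> ext_norm E"
abbreviation "PS \<equiv> poincare_sphere E"
abbreviation "PU \<equiv> upper_hemisphere E"
abbreviation "PC \<equiv> closed_upper_hemisphere E"
abbreviation "sflow \<equiv> sphere_flow E \<Phi>"
abbreviation "pflow \<equiv> poincare_flow E \<Phi>"
abbreviation "\<pi>P \<equiv> poincare_proj E"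

lemma flow_0: "\<Phi> 0 v = v"
  and flow_add: "\<Phi> (s + t) v = \<Phi> s (\<Phi> t v)"
  and flow_scl: "\<Phi> t (scl c v) = scl c (\<Phi> t v)"
  using lf unfolding linear_flow_def by blast+

lemma continuous_flow: "continuous_on S (\<Phi> t)"
proof -
  have "continuous_on UNIV (\<lambda>(t, v). \<Phi> t v)" using lf unfolding linear_flow_def by blast
  from continuous_on_compose2[OF this, of S "\<lambda>v. (t, v)"] show ?thesis
    by (simp add: continuous_on_Pair)
qed

text \<open>\<open>nrm v = 0\<close> means \<open>scl 0 v = v\<close>, which the flow preserves
  since it commutes with \<open>scl\<close>; the converse uses the flow for time
  \<open>- t\<close>.\<close>

lemma nrm_flow_eq_0_iff [simp]: "nrm (\<Phi> t v) = 0 \<longleftrightarrow> nrm v = 0"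
proof -
  have *: "nrm (\<Phi> t v) = 0" if "nrm v = 0" for t v
    using that flow_scl[of t 0 v] by (simp flip: scl_0_eq_iff)
  show ?thesis using *[of v t] *[of "\<Phi> t v" "- t"] flow_add[of "- t" t v] flow_0 by auto
qed

lemma nrm_pos_iff: "nrm v > 0 \<longleftrightarrow> nrm v \<noteq> 0"
  using nrm_nonneg[of v] by linarith

text \<open>Normalizing after each flight or once at the end gives the same vector, because the flow
  commutes with scaling; the norm of a unit vector never becomes 0 under the flow.\<close>

lemma compatible_flow_sphere:
  assumes "compatible_metric SV dS"
  shows "compatible_flow SV dS sflow"
proof
  show "compatible_metric SV dS" by fact
  show "sflow t x \<in> SV" if "x \<in> SV" for x t
    using that by (simp add: sphere_flow_def)
  show "sflow (s + t) x = sflow s (sflow t x)" if "x \<in> SV" for x s t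
    using that by (simp add: sphere_flow_def flow_scl flow_add)
  show "continuous_on SV (sflow t)" for t
    unfolding sphere_flow_def[abs_def]
    by (intro continuous_intros continuous_on_fib_scale continuous_on_fib_norm continuous_flow) auto
qed

section \<open>The flow on the Poincare sphere bundle\<close>

lemma xnrm_eq: "xnrm (v, r) = sqrt ((nrm v)\<^sup>2 + r\<^sup>2)"
  by (simp add: ext_norm_def)

lemma xnrm_nonneg [simp]: "xnrm p \<ge> 0"
  by (cases p) (simp add: xnrm_eq)

lemma xnrm_eq_0_iff: "xnrm (v, r) = 0 \<longleftrightarrow> nrm v = 0 \<and> r = 0"
  by (simp add: xnrm_eq sum_power2_eq_zero_iff)

lemma xnrm_scl: "xnrm (scl c v, c * r) = \<bar>c\<bar> * xnrm (v, r)"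
  by (simp add: xnrm_eq power_mult_distrib real_sqrt_mult flip: distrib_left)

lemma continuous_xnrm: "continuous_on S xnrm"
proof -
  have "xnrm = (\<lambda>p. sqrt ((nrm (fst p))\<^sup>2 + (snd p)\<^sup>2))" by (auto simp: ext_norm_def)
  then show ?thesis by (auto intro!: continuous_intros continuous_on_fib_norm)
qed

lemma pflow_eq:
  "pflow t (v, r) = (scl (1 / xnrm (\<Phi> t v, r)) (\<Phi> t v), r / xnrm (\<Phi> t v, r))"
  by (simp add: poincare_flow_def ext_flow_def ext_scale)

lemma mem_PS: "(v, r) \<in> PS \<longleftrightarrow> xnrm (v, r) = 1"
  by (simp add: poincare_sphere_def)

lemma mem_PC: "(v, r) \<in> PC \<longleftrightarrow> xnrm (v, r) = 1 \<and> r \<ge> 0"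
  by (simp add: closed_upper_hemisphere_def mem_PS)

lemma mem_PU: "(v, r) \<in> PU \<longleftrightarrow> xnrm (v, r) = 1 \<and> r > 0"
  by (simp add: upper_hemisphere_def mem_PS)

lemma PC_subset: "PC \<subseteq> PS" and PU_subset: "PU \<subseteq> PC"
  by (auto simp: mem_PC mem_PS mem_PU)

lemma xnrm_flow_pos: "xnrm (v, r) = 1 \<Longrightarrow> xnrm (\<Phi> t v, r) > 0"
  using xnrm_nonneg[of "(\<Phi> t v, r)"] xnrm_eq_0_iff[of "\<Phi> t v" r] xnrm_eq_0_iff[of v r]
  by (auto simp: less_le)

lemma xnrm_normalized: "xnrm (v, r) > 0 \<Longrightarrow> xnrm (scl (1 / xnrm (v, r)) v, r / xnrm (v, r)) = 1"
  using xnrm_scl[of "1 / xnrm (v, r)" v r] by simp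

lemma pflow_PC: "p \<in> PC \<Longrightarrow> pflow t p \<in> PC"
  by (cases p) (auto simp: mem_PC pflow_eq xnrm_normalized[OF xnrm_flow_pos])

lemma compatible_flow_poincare:
  assumes "compatible_metric PS dP"
  shows "compatible_flow PS dP pflow"
proof
  show "compatible_metric PS dP" by fact
  show "pflow t p \<in> PS" if "p \<in> PS" for p t
    using that by (cases p) (auto simp: mem_PS pflow_eq xnrm_normalized[OF xnrm_flow_pos])
  show "pflow (s + t) p = pflow s (pflow t p)" if p: "p \<in> PS" for p s t
  proof (cases p)
    case (Pair v r)
    \<comment> \<open>The first normalizing factor; the second one is
      \<open>xnrm (\<Phi> (s + t) v, r) / n\<close>, so \<open>n\<close> cancels in both
      components.\<close>
    define n where "n = xnrm (\<Phi> t v, r)"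
    have n: "n > 0" unfolding n_def using xnrm_flow_pos p Pair by (auto simp: mem_PS)
    have "xnrm (\<Phi> s (scl (1 / n) (\<Phi> t v)), r / n) = xnrm (\<Phi> (s + t) v, r) / n"
      using xnrm_scl[of "1 / n" "\<Phi> (s + t) v" r] n by (simp add: flow_scl flow_add)
    then show ?thesis unfolding Pair pflow_eq n_def[symmetric]
      using n by (simp add: flow_scl flow_add)
  qed
  show "continuous_on PS (pflow t)" for t
  proof -
    have eq: "pflow t = (\<lambda>p. (scl (1 / xnrm (\<Phi> t (fst p), snd p)) (\<Phi> t (fst p)),
        snd p / xnrm (\<Phi> t (fst p), snd p)))" by (auto simp: pflow_eq)
    have c: "continuous_on PS (\<lambda>p. \<Phi> t (fst p))"
      by (rule continuous_on_compose2[OF continuous_flow[of UNIV]]) (auto intro: continuous_intros)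
    have "continuous_on PS (\<lambda>p. xnrm (\<Phi> t (fst p), snd p))"
      by (rule continuous_on_compose2[OF continuous_xnrm[of UNIV]])
        (auto intro!: continuous_intros c)
    moreover have "\<forall>p\<in>PS. xnrm (\<Phi> t (fst p), snd p) \<noteq> 0"
      using xnrm_flow_pos[of _ _ t] by (metis less_irrefl mem_PS prod.collapse)
    ultimately show ?thesis unfolding eq
      by (intro continuous_intros continuous_on_fib_scale c)
  qed
qed

text \<open>The closure of the projected cone is formed in the ambient type; closedness keeps it
  inside the hemisphere.\<close>

lemma closed_PC: "closed PC"
proof -
  have "PC = {p. xnrm p = 1} \<inter> {p. snd p \<ge> 0}" by (auto simp: mem_PC)
  then show ?thesis
    by (auto intro!: closed_Int closed_Collect_eq closed_Collect_le continuous_xnrm continuous_intros)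
qed

section \<open>The projection \<open>\<pi>P\<close> and the meridians\<close>

lemma proj_P_eq: "\<pi>P v = (scl (1 / sqrt ((nrm v)\<^sup>2 + 1)) v, 1 / sqrt ((nrm v)\<^sup>2 + 1))"
  by (simp add: poincare_proj_def xnrm_eq)

lemma proj_P_mem: "\<pi>P v \<in> PU"
proof -
  have "xnrm (v, 1) > 0" by (simp add: xnrm_eq add_nonneg_pos)
  then show ?thesis using xnrm_normalized[of v 1] by (simp add: poincare_proj_def mem_PU)
qed

text \<open>\<open>\<pi>P v\<close> is a positive multiple of \<open>(v, 1)\<close>, and the
  extended flow commutes with multiples, so both sides normalize
  \<open>(\<Phi> t v, 1)\<close>.\<close>

lemma pflow_proj_P: "pflow t (\<pi>P v) = \<pi>P (\<Phi> t v)"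
proof -
  define n where "n = xnrm (v, 1)"
  have n: "n > 0" unfolding n_def by (simp add: xnrm_eq add_nonneg_pos)
  have "xnrm (\<Phi> t (scl (1 / n) v), 1 / n) = xnrm (\<Phi> t v, 1) / n"
    using xnrm_scl[of "1 / n" "\<Phi> t v" 1] n by (simp add: flow_scl)
  then show ?thesis unfolding poincare_proj_def n_def[symmetric] pflow_eq
    using n by (simp add: flow_scl)
qed

text \<open>The meridian through \<open>u\<close>, parametrized by the norm of the first component; unlike
  \<open>\<rho> \<mapsto> \<pi>P (\<rho> u)\<close> it is defined on a compact interval.\<close>

definition meridian :: "'v \<Rightarrow> real \<Rightarrow> 'v \<times> real" where
  "meridian u s = (scl s u, sqrt (1 - s\<^sup>2))"

text \<open>The substitution \<open>s = \<rho> / sqrt (\<rho>\<^sup>2 + 1)\<close> compresses all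
  \<open>\<rho> > 0\<close> into the unit interval, with
  \<open>1 - s\<^sup>2 = 1 / (\<rho>\<^sup>2 + 1)\<close>.\<close>

lemma proj_P_meridian:
  assumes "u \<in> SV" "\<rho> > 0"
  shows "\<pi>P (scl \<rho> u) = meridian u (\<rho> / sqrt (\<rho>\<^sup>2 + 1))"
proof -
  have pos: "\<rho>\<^sup>2 + 1 > 0" by (simp add: add_nonneg_pos)
  then have "1 - (\<rho> / sqrt (\<rho>\<^sup>2 + 1))\<^sup>2 = 1 / (\<rho>\<^sup>2 + 1)"
    by (simp add: power_divide field_simps)
  then show ?thesis using assms by (simp add: proj_P_eq meridian_def real_sqrt_divide)
qed

lemma meridian_PC: "u \<in> SV \<Longrightarrow> s \<in> {0..1} \<Longrightarrow> meridian u s \<in> PC"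
  by (simp add: meridian_def mem_PC xnrm_eq abs_square_le_1)

lemma continuous_meridian: "continuous_on S (\<lambda>(u, s). meridian u s)"
  unfolding meridian_def case_prod_beta
  by (intro continuous_intros continuous_on_fib_scale)

text \<open>An equator point \<open>(v, 0)\<close> is the end \<open>s = 1\<close> of the meridian
  through \<open>v\<close>, whose points with \<open>s < 1\<close> lie in \<open>PU\<close>.\<close>

lemma PC_subset_closure: "PC \<subseteq> closure PU"
proof clarify
  fix v r assume p: "(v, r) \<in> PC"
  show "(v, r) \<in> closure PU"
  proof (cases "r > 0")
    case True
    then show ?thesis using p closure_subset[of PU] by (auto simp: mem_PC mem_PU)
  next
    case False
    with p have "r = 0" by (simp add: mem_PC)
    with p have r: "r = 0" "v \<in> SV" by (simp_all add: mem_PC xnrm_eq)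
    have "meridian v ` closure {0..<1} \<subseteq> closure PU"
    proof (rule image_closure_subset)
      show "continuous_on (closure {0..<1}) (meridian v)"
        unfolding meridian_def by (intro continuous_intros continuous_on_fib_scale)
      have "meridian v s \<in> PU" if "s \<in> {0..<1}" for s
        using that r(2)
        by (simp add: meridian_def mem_PU xnrm_eq abs_square_le_1 abs_square_less_1)
      then show "meridian v ` {0..<1} \<subseteq> closure PU" using closure_subset[of PU] by blast
    qed simp
    moreover have "meridian v 1 = (v, r)" using r by (simp add: meridian_def)
    ultimately show ?thesis by (metis atLeastAtMost_iff closure_atLeastLessThan image_subset_iff 
          order_refl zero_le_one zero_less_one zero_neq_one)
  qed
qed

section \<open>Lifting chains from the sphere bundle to the open hemisphere\<close>

text \<open>\<open>meridian\<close> is continuous on the compact set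
  \<open>SV \<times> {0..1}\<close>, hence uniformly so; every \<open>\<rho> > 0\<close> gives a
  parameter in that interval, so one \<open>\<delta>\<close> serves all \<open>\<rho>\<close>,
  however large.\<close>

lemma proj_P_uniformly_continuous:
  assumes S: "compatible_metric SV dS" and P: "compatible_metric PS dP" and "\<epsilon> > 0"
  shows "\<exists>\<delta>>0. \<forall>u\<in>SV. \<forall>w\<in>SV. dS u w < \<delta> \<longrightarrow>
           (\<forall>\<rho>>0. dP (\<pi>P (scl \<rho> u)) (\<pi>P (scl \<rho> w)) < \<epsilon>)"
proof -
  interpret S: Metric_space SV dS using S by (simp add: compatible_metric_def)
  interpret P: Metric_space PS dP using P by (simp add: compatible_metric_def)
  \<comment> \<open>\<open>dS\<close> and \<open>dP\<close> are metrics on subsets only, so the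
    Heine-Cantor theorem is applied to abstract metric spaces.\<close>
  define m1 where "m1 = prod_metric S.Self (submetric euclidean_metric {0..1::real})"
  have top1: "mtopology_of m1 = top_of_set (SV \<times> {0..1})"
    using S by (simp add: m1_def mtopology_of_submetric S.Self_def compatible_metric_def)
  have top2: "mtopology_of P.Self = top_of_set PS"
    using P by (simp add: P.Self_def compatible_metric_def)
  have "compact (SV \<times> {0..1::real})" by (intro compact_Times compact_sphere compact_Icc)
  then have "compact_space (mtopology_of m1)" by (simp add: top1 compact_space_subtopology)
  moreover have "continuous_map (mtopology_of m1) (mtopology_of P.Self) (\<lambda>(u, s). meridian u s)"
    unfolding top1 top2 using continuous_meridian meridian_PC PC_subset
    by (auto simp: image_subset_iff)
  ultimately have "uniformly_continuous_map m1 P.Self (\<lambda>(u, s). meridian u s)"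
    using continuous_eq_uniformly_continuous_map by blast
  then obtain \<delta> where \<delta>: "\<delta> > 0" "\<And>p q. p \<in> SV \<times> {0..1} \<Longrightarrow> q \<in> SV \<times> {0..1} \<Longrightarrow>
      prod_dist dS dist q p < \<delta> \<Longrightarrow>
      dP (case q of (u, s) \<Rightarrow> meridian u s) (case p of (u, s) \<Rightarrow> meridian u s) < \<epsilon>"
    using \<open>\<epsilon> > 0\<close> unfolding uniformly_continuous_map_def m1_def by fastforce
  have "dP (\<pi>P (scl \<rho> u)) (\<pi>P (scl \<rho> w)) < \<epsilon>"
    if uw: "u \<in> SV" "w \<in> SV" "dS u w < \<delta>" "\<rho> > 0" for u w \<rho>
  proof -
    define s where "s = \<rho> / sqrt (\<rho>\<^sup>2 + 1)"
    have "\<rho> \<le> sqrt (\<rho>\<^sup>2 + 1)" using that by (intro real_le_rsqrt) simp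
    moreover have "sqrt (\<rho>\<^sup>2 + 1) > 0" by (simp add: add_nonneg_pos)
    ultimately have "s \<in> {0..1}" using that by (simp add: s_def divide_le_eq_1_pos)
    \<comment> \<open>The second coordinates agree, so the product distance is just
      \<open>dS u w\<close>.\<close>
    then have "dP (meridian u s) (meridian w s) < \<epsilon>"
      using \<delta>(2)[of "(w, s)" "(u, s)"] uw by (simp add: prod_dist_def)
    then show ?thesis unfolding s_def using proj_P_meridian that by simp
  qed
  then show ?thesis using \<delta>(1) by blast
qed

text \<open>By linearity a jump of \<open>sflow\<close> lifts to all radii at once: the flight
  multiplies the radius by the norm growth of the unit vector, whatever \<open>\<rho>\<close> is,
  and the uniform estimate bounds the jump error. Along the chain the growth factors multiply to
  \<open>c\<close>.\<close>

lemma proj_P_chain_lift: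
  assumes S: "compatible_metric SV dS" and P: "compatible_metric PS dP" and "\<epsilon> > 0"
  shows "\<exists>\<delta>>0. \<forall>x y. is_chain SV dS sflow \<delta> T x y \<longrightarrow>
           (\<exists>c>0. \<forall>\<rho>>0. is_chain PU dP pflow \<epsilon> T (\<pi>P (scl \<rho> x)) (\<pi>P (scl (\<rho> * c) y)))"
proof -
  obtain \<delta> where \<delta>: "\<delta> > 0" "\<And>u w \<rho>. u \<in> SV \<Longrightarrow> w \<in> SV \<Longrightarrow> dS u w < \<delta> \<Longrightarrow> \<rho> > 0 \<Longrightarrow>
      dP (\<pi>P (scl \<rho> u)) (\<pi>P (scl \<rho> w)) < \<epsilon>"
    using proj_P_uniformly_continuous[OF assms] by blast
  have lift: "\<exists>c>0. \<forall>\<rho>>0. is_chain PU dP pflow \<epsilon> T (\<pi>P (scl \<rho> x)) (\<pi>P (scl (\<rho> * c) y))"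
    if step: "chain_step SV dS sflow \<delta> T x y" for x y
  proof -
    obtain t where xy: "x \<in> SV" "y \<in> SV" and t: "t \<ge> T" "dS (sflow t x) y < \<delta>"
      using step unfolding chain_step_def by blast
    \<comment> \<open>Norm growth along the flight: \<open>\<Phi> t (scl \<rho> x)\<close> is
      \<open>\<rho> * c\<close> times the unit vector \<open>sflow t x\<close>.\<close>
    define c where "c = nrm (\<Phi> t x)"
    have c: "c > 0" using xy(1) by (simp add: c_def nrm_pos_iff)
    have sx: "sflow t x \<in> SV" using xy(1) by (simp add: sphere_flow_def)
    have "is_chain PU dP pflow \<epsilon> T (\<pi>P (scl \<rho> x)) (\<pi>P (scl (\<rho> * c) y))" if "\<rho> > 0" for \<rho>
    proof (rule is_chain_single)
      have "pflow t (\<pi>P (scl \<rho> x)) = \<pi>P (scl (\<rho> * c) (sflow t x))"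
        using c by (simp add: pflow_proj_P flow_scl sphere_flow_def flip: c_def)
      moreover have "\<rho> * c > 0" using c that by simp
      ultimately have "dP (pflow t (\<pi>P (scl \<rho> x))) (\<pi>P (scl (\<rho> * c) y)) < \<epsilon>"
        using \<delta>(2)[OF sx xy(2) t(2)] by simp
      then show "chain_step PU dP pflow \<epsilon> T (\<pi>P (scl \<rho> x)) (\<pi>P (scl (\<rho> * c) y))"
        unfolding chain_step_def using t(1) proj_P_mem by blast
    qed
    then show ?thesis using c by blast
  qed
  have "\<exists>c>0. \<forall>\<rho>>0. is_chain PU dP pflow \<epsilon> T (\<pi>P (scl \<rho> x)) (\<pi>P (scl (\<rho> * c) y))"
    if "(chain_step SV dS sflow \<delta> T)\<^sup>+\<^sup>+ x y" for x y
    using that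
  proof (induction rule: tranclp_induct)
    case (step y z)
    obtain c where c: "c > 0"
      "\<And>\<rho>. \<rho> > 0 \<Longrightarrow> is_chain PU dP pflow \<epsilon> T (\<pi>P (scl \<rho> x)) (\<pi>P (scl (\<rho> * c) y))"
      using step.IH by blast
    obtain e where e: "e > 0"
      "\<And>\<rho>. \<rho> > 0 \<Longrightarrow> is_chain PU dP pflow \<epsilon> T (\<pi>P (scl \<rho> y)) (\<pi>P (scl (\<rho> * e) z))"
      using lift[OF step.hyps(2)] by blast
    \<comment> \<open>The second lift starts at radius \<open>\<rho> * c\<close>, which is why lifts
      are claimed for every positive radius.\<close>
    have "is_chain PU dP pflow \<epsilon> T (\<pi>P (scl \<rho> x)) (\<pi>P (scl (\<rho> * (c * e)) z))" if "\<rho> > 0" for \<rho>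
      using is_chain_trans[OF c(2)[OF that] e(2)[of "\<rho> * c"]] that c(1) by (simp add: mult.assoc)
    then show ?case using c(1) e(1) by (intro exI[of _ "c * e"]) simp
  qed (rule lift)
  then show ?thesis unfolding is_chain_iff_tranclp using \<delta>(1) by blast
qed

text \<open>The lifted chains from \<open>x\<close> to \<open>v0\<close> and from \<open>v0\<close>
  to \<open>y\<close> change the radius by uncontrolled factors \<open>c\<close> and
  \<open>e\<close>. A chain between two points of the half-line adjusts the radius in
  between.\<close>

lemma chain_transitive_cone:
  assumes S: "compatible_metric SV dS" and P: "compatible_metric PS dP"
    and M: "chain_transitive SV dS sflow M" and v0: "v0 \<in> M"
    and l: "chain_transitive PU dP pflow (\<pi>P ` half_line E v0)"
  shows "chain_transitive PU dP pflow (\<pi>P ` cone_bundle E M)"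
proof (rule chain_transitiveI)
  show "\<pi>P ` cone_bundle E M \<subseteq> PU" using proj_P_mem by blast
  fix p q and \<epsilon> T :: real
  assume p: "p \<in> \<pi>P ` cone_bundle E M" and q: "q \<in> \<pi>P ` cone_bundle E M" and pos: "\<epsilon> > 0" "T > 0"
  obtain \<alpha> x where x: "p = \<pi>P (scl \<alpha> x)" "\<alpha> > 0" "x \<in> M"
    using p unfolding cone_bundle_def by blast
  obtain \<beta> y where y: "q = \<pi>P (scl \<beta> y)" "\<beta> > 0" "y \<in> M"
    using q unfolding cone_bundle_def by blast
  obtain \<delta> where \<delta>: "\<delta> > 0" "\<And>x y. is_chain SV dS sflow \<delta> T x y \<Longrightarrow>
      \<exists>c>0. \<forall>\<rho>>0. is_chain PU dP pflow \<epsilon> T (\<pi>P (scl \<rho> x)) (\<pi>P (scl (\<rho> * c) y))"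
    using proj_P_chain_lift[OF S P pos(1)] by blast
  obtain c where c: "c > 0" "\<And>\<rho>. \<rho> > 0 \<Longrightarrow> is_chain PU dP pflow \<epsilon> T (\<pi>P (scl \<rho> x)) (\<pi>P (scl (\<rho> * c) v0))"
    using \<delta>(2)[OF chain_transitiveD[OF M x(3) v0 \<delta>(1) pos(2)]] by blast
  obtain e where e: "e > 0" "\<And>\<rho>. \<rho> > 0 \<Longrightarrow> is_chain PU dP pflow \<epsilon> T (\<pi>P (scl \<rho> v0)) (\<pi>P (scl (\<rho> * e) y))"
    using \<delta>(2)[OF chain_transitiveD[OF M v0 y(3) \<delta>(1) pos(2)]] by blast
  have half: "scl \<rho> v0 \<in> half_line E v0" if "\<rho> > 0" for \<rho>
    using that unfolding half_line_def by blast
  \<comment> \<open>\<open>\<beta> / e\<close> is the radius from which the lifted chain to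
    \<open>y\<close> ends at radius \<open>\<beta>\<close>.\<close>
  have "is_chain PU dP pflow \<epsilon> T (\<pi>P (scl (\<alpha> * c) v0)) (\<pi>P (scl (\<beta> / e) v0))"
    using x y c(1) e(1) by (intro chain_transitiveD[OF l _ _ pos] imageI half) auto
  moreover have "is_chain PU dP pflow \<epsilon> T p (\<pi>P (scl (\<alpha> * c) v0))"
    using c(2)[OF x(2)] x(1) by simp
  moreover have "is_chain PU dP pflow \<epsilon> T (\<pi>P (scl (\<beta> / e) v0)) q"
    using e(2)[of "\<beta> / e"] e(1) y by simp
  ultimately show "is_chain PU dP pflow \<epsilon> T p q" using is_chain_trans by metis
qed

end

section \<open>Equivalence of chain transitivity for the cone and for one half-line\<close>

theorem theorem4p3:
  fixes E :: "('v::topological_space, 'b::metric_space, 'h::euclidean_space, 'a) vbundle"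
    and \<Phi> :: "real \<Rightarrow> 'v \<Rightarrow> 'v"
    and dS :: "'v \<Rightarrow> 'v \<Rightarrow> real"
    and dP :: "'v \<times> real \<Rightarrow> 'v \<times> real \<Rightarrow> real"
    and M :: "'v set"
  assumes "vector_bundle E"
    and "linear_flow E \<Phi>"
    and "chain_transitive UNIV dist (base_flow E \<Phi>) UNIV"
    and "compatible_metric (sphere_bundle E) dS"
    and "compatible_metric (poincare_sphere E) dP"
    and "chain_recurrent_component (sphere_bundle E) dS (sphere_flow E \<Phi>) M"
  shows "chain_transitive (closed_upper_hemisphere E) dP (poincare_flow E \<Phi>)
           (closure (poincare_proj E ` cone_bundle E M))
     \<longleftrightarrow> (\<exists>v0\<in>M. half_line E v0 \<subseteq> cone_bundle E M \<and>
           chain_transitive (upper_hemisphere E) dP (poincare_flow E \<Phi>)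
             (poincare_proj E ` half_line E v0))"
proof -
  interpret linear_flow_locale E \<Phi> using assms(1,2) by unfold_locales
  interpret S: compatible_flow SV dS sflow by (rule compatible_flow_sphere[OF assms(4)])
  interpret P: compatible_flow PS dP pflow by (rule compatible_flow_poincare[OF assms(5)])
  have M: "chain_transitive SV dS sflow M"
    using assms(6) by (simp add: chain_recurrent_component_def)
  \<comment> \<open>The inclusion demanded of the half-line holds for every \<open>v0\<close> in
    \<open>M\<close>, so any element can serve as witness.\<close>
  have half: "half_line E v0 \<subseteq> cone_bundle E M" if "v0 \<in> M" for v0
    using that unfolding half_line_def cone_bundle_def by blast
  have cone: "\<pi>P ` cone_bundle E M \<subseteq> PU" using proj_P_mem by blast
  show ?thesis
  proof
    assume a: "chain_transitive PC dP pflow (closure (\<pi>P ` cone_bundle E M))"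
    obtain v0 where v0: "v0 \<in> M"
      using S.chain_recurrent_component_nonempty[OF compact_sphere sphere_nonempty assms(6)] by blast
    have "chain_transitive PU dP pflow (\<pi>P ` cone_bundle E M)"
    proof (rule chain_transitiveI[OF cone])
      fix p q and \<epsilon> T :: real
      assume pq: "p \<in> \<pi>P ` cone_bundle E M" "q \<in> \<pi>P ` cone_bundle E M" and pos: "\<epsilon> > 0" "T > 0"
      have "p \<in> PU" "q \<in> PU" using subsetD[OF cone] pq by blast+
      moreover have "is_chain PC dP pflow \<epsilon> T p q"
        using chain_transitiveD[OF a subsetD[OF closure_subset pq(1)] subsetD[OF closure_subset pq(2)] pos] .
      \<comment> \<open>Chains of the closed hemisphere are moved off the equator; \<open>p\<close>
        and \<open>q\<close> lie in \<open>PU\<close> and stay fixed.\<close>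
      ultimately show "is_chain PU dP pflow \<epsilon> T p q"
        by (rule P.is_chain_dense[OF PC_subset PU_subset PC_subset_closure])
    qed
    then have "chain_transitive PU dP pflow (\<pi>P ` half_line E v0)"
      by (rule chain_transitive_subset) (use half[OF v0] in blast)
    with v0 half show "\<exists>v0\<in>M. half_line E v0 \<subseteq> cone_bundle E M \<and>
        chain_transitive PU dP pflow (\<pi>P ` half_line E v0)" by blast
  next
    assume "\<exists>v0\<in>M. half_line E v0 \<subseteq> cone_bundle E M \<and>
        chain_transitive PU dP pflow (\<pi>P ` half_line E v0)"
    then have "chain_transitive PU dP pflow (\<pi>P ` cone_bundle E M)"
      using chain_transitive_cone[OF assms(4,5) M] by blast
    \<comment> \<open>The chain space is enlarged to \<open>PC\<close> before taking the closure,
      which may reach the equator.\<close>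
    then have "chain_transitive PC dP pflow (\<pi>P ` cone_bundle E M)"
      by (rule chain_transitive_mono) (rule PU_subset)
    moreover have "closure (\<pi>P ` cone_bundle E M) \<subseteq> PC"
      using cone PU_subset by (intro closure_minimal closed_PC) blast
    ultimately show "chain_transitive PC dP pflow (closure (\<pi>P ` cone_bundle E M))"
      by (intro P.chain_transitive_closure PC_subset pflow_PC)
  qed
qed

end
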